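(* Let $A_1$ and $A_2$ be two points on the sphere $\mathbb{S}^2$, respectively in the hyperbolic plane $\mathbb{H}^2$. Define an ellipse with foci $A_1,A_2$ as the set of points with a constant sum of geodesic distances to $A_1$ and $A_2$, and a hyperbola with foci $A_1,A_2$ as the set of points with a constant absolute value of the difference of these distances. Then in every curvilinear quadrilateral cut out by the confocal family of ellipses and hyperbolas with foci $A_1,A_2$, the two diagonals have equal geodesic lengths.
   Context: A curvilinear quadrilateral cut out by the confocal family is a quadrilateral whose one pair of opposite sides consists of arcs of two ellipses and whose other pair of opposite sides consists of arcs of two hyperbolas of the family (all with the same foci $A_1,A_2$). Its diagonals are the geodesic segments joining opposite vertices. The sphere is the unit sphere and the hyperbolic plane has curvature $-1$.
   Formalization: The two foci are assumed distinct and, on the sphere, not antipodal; the quadrilateral is a closed disc whose interior contains no focus (on the sphere, also no antipode of a focus), since with arbitrary bounding arcs the claim fails. *)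

theory Defs
  imports "HOL-Analysis.Analysis"
begin

definition sphere_dist :: "real^3 \<Rightarrow> real^3 \<Rightarrow> real" where
  "sphere_dist P Q = arccos (P \<bullet> Q)"

text \<open>The hyperbolic plane of curvature \<open>-1\<close> in the hyperboloid model: the upper sheet of
  \<open>\<langle>P, P\<rangle> = -1\<close> in Minkowski space, with \<open>cosh d(P, Q) = -\<langle>P, Q\<rangle>\<close>.\<close>

definition minkowski_form :: "real^3 \<Rightarrow> real^3 \<Rightarrow> real" where
  "minkowski_form P Q = P $ 1 * Q $ 1 + P $ 2 * Q $ 2 - P $ 3 * Q $ 3"

definition hyperbolic_plane :: "(real^3) set" where
  "hyperbolic_plane = {P. minkowski_form P P = -1 \<and> P $ 3 > 0}"

definition hyperbolic_dist :: "real^3 \<Rightarrow> real^3 \<Rightarrow> real" where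
  "hyperbolic_dist P Q = arcosh (- minkowski_form P Q)"

definition ellipse :: "'a set \<Rightarrow> ('a \<Rightarrow> 'a \<Rightarrow> real) \<Rightarrow> 'a \<Rightarrow> 'a \<Rightarrow> real \<Rightarrow> 'a set" where
  "ellipse M d A1 A2 k = {P \<in> M. d P A1 + d P A2 = k}"

definition hyperbola :: "'a set \<Rightarrow> ('a \<Rightarrow> 'a \<Rightarrow> real) \<Rightarrow> 'a \<Rightarrow> 'a \<Rightarrow> real \<Rightarrow> 'a set" where
  "hyperbola M d A1 A2 k = {P \<in> M. \<bar>d P A1 - d P A2\<bar> = k}"

text \<open>A curvilinear quadrilateral is an embedded closed disc in the surface \<open>M\<close>, presented as the
  homeomorphic image of the unit square under \<open>Q\<close>; the vertices are the images of the corners.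
  Two opposite sides lie on ellipses and the other two on hyperbolas. The two hyperbola sides may
  lie on the two branches of the same hyperbola.

  \<open>F\<close> is the set of singular points of the confocal family. They may be vertices, but not interior
  points of the disc: this is what makes the disc a cell of the net of confocal curves. Without it,
  an arc of a hyperbola could run across an ellipse to its second intersection point with that
  ellipse, giving a disc that contains a focus, has a reflex angle at one of its vertices, and has
  diagonals of different lengths.\<close>

definition curvilinear_quadrilateral ::
  "'a::topological_space set \<Rightarrow> ('a \<Rightarrow> 'a \<Rightarrow> real) \<Rightarrow> 'a set \<Rightarrow> 'a \<Rightarrow> 'a \<Rightarrow> (real \<times> real \<Rightarrow> 'a) \<Rightarrow> bool"
  where
  "curvilinear_quadrilateral M d F A1 A2 Q \<longleftrightarrow>
     continuous_on ({0..1} \<times> {0..1}) Q \<and> inj_on Q ({0..1} \<times> {0..1}) \<and>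
     Q ` ({0..1} \<times> {0..1}) \<subseteq> M \<and>
     (\<forall>j\<in>{0, 1}. \<exists>k. \<forall>s\<in>{0..1}. Q (s, j) \<in> ellipse M d A1 A2 k) \<and>
     (\<forall>i\<in>{0, 1}. \<exists>k. \<forall>t\<in>{0..1}. Q (i, t) \<in> hyperbola M d A1 A2 k) \<and>
     Q ` ({0<..<1} \<times> {0<..<1}) \<inter> F = {}"

text \<open>Since \<open>d P (- A) = pi - d P A\<close> on the sphere, an ellipse or hyperbola with foci \<open>A1\<close>, \<open>A2\<close> is
  also one with foci \<open>- A1\<close>, \<open>- A2\<close>, so the spherical family has four foci.\<close>

definition spherical_quadrilateral :: "real^3 \<Rightarrow> real^3 \<Rightarrow> (real \<times> real \<Rightarrow> real^3) \<Rightarrow> bool" where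
  "spherical_quadrilateral A1 A2 =
     curvilinear_quadrilateral (sphere 0 1) sphere_dist {A1, A2, - A1, - A2} A1 A2"

definition hyperbolic_quadrilateral :: "real^3 \<Rightarrow> real^3 \<Rightarrow> (real \<times> real \<Rightarrow> real^3) \<Rightarrow> bool" where
  "hyperbolic_quadrilateral A1 A2 =
     curvilinear_quadrilateral hyperbolic_plane hyperbolic_dist {A1, A2} A1 A2"

end

theory Submission
  imports Defs
begin

text \<open>Write \<open>r\<^sub>i = d(P, A\<^sub>i)\<close>, \<open>p\<^sub>i = cos r\<^sub>i\<close>, \<open>m = cos d(A\<^sub>1, A\<^sub>2)\<close> and \<open>D(P) = det(A\<^sub>1, A\<^sub>2, P)\<close>. The complex
  function \<open>w = m - p\<^sub>1 p\<^sub>2 + i D\<close> has modulus \<open>sin r\<^sub>1 sin r\<^sub>2\<close>, so it vanishes only at the singular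
  points, and \<open>\<bar>w\<bar> + Re w = m - cos (r\<^sub>1 + r\<^sub>2)\<close>, \<open>\<bar>w\<bar> - Re w = cos (r\<^sub>1 - r\<^sub>2) - m\<close>. The quadrilateral is
  contractible, hence \<open>w\<close> has a continuous square root \<open>g\<close> on it; \<open>Re g\<close> is constant on the elliptic
  sides and \<open>Im g\<close> on the hyperbolic ones, so \<open>D = 2 Re g Im g\<close> has the same product over
  both pairs of opposite vertices. The same holds for the symmetric expressions in \<open>p\<^sub>1, p\<^sub>2\<close> that, by
  the Gram determinant, together with \<open>D\<close> determine the inner product of two points. In the
  hyperbolic plane \<open>cosh\<close> replaces \<open>cos\<close> and \<open>Re w\<close> changes its sign.\<close>

section \<open>Square roots on the unit square\<close>

text \<open>A continuous function with constant square takes at most two values, and the interval is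
  connected. This excludes a change of sign along a side.\<close>

lemma continuous_on_interval_power2_const:
  fixes f :: "real \<Rightarrow> real"
  assumes "continuous_on {0..1} f" and sq: "\<And>t. t \<in> {0..1} \<Longrightarrow> (f t)\<^sup>2 = c"
  shows "f 1 = f 0"
proof -
  have "f ` {0..1} \<subseteq> {sqrt c, - sqrt c}"
  proof (rule image_subsetI)
    fix t :: real
    assume "t \<in> {0..1}"
    then have "\<bar>f t\<bar> = sqrt c"
      using sq real_sqrt_abs[of "f t"] by simp
    then show "f t \<in> {sqrt c, - sqrt c}"
      by (simp add: abs_if split: if_splits)
  qed
  then have "finite (f ` {0..1})"
    by (rule finite_subset) simp
  then have "f constant_on {0..1}"
    using continuous_finite_range_constant[of "{0..1::real}" f] assms(1) by auto
  then show ?thesis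
    by (auto simp: constant_on_def)
qed

lemma continuous_on_square_sides:
  fixes f :: "real \<times> real \<Rightarrow> 'b::topological_space"
  assumes "continuous_on ({0..1} \<times> {0..1}) f" "i \<in> {0, 1}"
  shows "continuous_on {0..1} (\<lambda>t. f (i, t))" "continuous_on {0..1} (\<lambda>s. f (s, i))"
  by (rule continuous_on_compose2[OF assms(1)]; use assms(2) in \<open>auto intro!: continuous_intros\<close>)+

text \<open>The numbers \<open>a j\<close> and \<open>b i\<close> are twice the squares of the real
  and imaginary parts of any square root of \<open>w\<close> on the sides. A root that is continuous
  on the square keeps these parts constant, signs included, along the sides.\<close>

lemma Im_products_of_opposite_corners:
  fixes w :: "real \<times> real \<Rightarrow> complex"
  assumes cont: "continuous_on ({0..1} \<times> {0..1}) w"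
    and nz: "\<And>z. z \<in> {0<..<1} \<times> {0<..<1} \<Longrightarrow> w z \<noteq> 0"
    and a: "\<And>s j. j \<in> {0, 1} \<Longrightarrow> s \<in> {0..1} \<Longrightarrow> cmod (w (s, j)) + Re (w (s, j)) = a j"
    and b: "\<And>i t. i \<in> {0, 1} \<Longrightarrow> t \<in> {0..1} \<Longrightarrow> cmod (w (i, t)) - Re (w (i, t)) = b i"
  shows "Im (w (0, 0)) * Im (w (1, 1)) = Im (w (1, 0)) * Im (w (0, 1))"
proof (cases "a 0 = 0 \<or> a 1 = 0 \<or> b 0 = 0 \<or> b 1 = 0")
  case True
  \<comment> \<open>Here \<open>w\<close> may vanish on the boundary, so no root is taken: the
    square of either product is \<open>a 0 * a 1 * b 0 * b 1\<close>, which is zero.\<close>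
  have "(Im (w (i, j)))\<^sup>2 = a j * b i" if "i \<in> {0, 1}" "j \<in> {0, 1}" for i j
  proof -
    have "(Im (w (i, j)))\<^sup>2 = (cmod (w (i, j)) + Re (w (i, j))) * (cmod (w (i, j)) - Re (w (i, j)))"
      by (simp add: cmod_power2 algebra_simps flip: power2_eq_square)
    also have "\<dots> = a j * b i"
      using a[of j i] b[of i j] that by auto
    finally show ?thesis .
  qed
  from this[of 0 0] this[of 1 1] this[of 1 0] this[of 0 1] True show ?thesis
    by auto
next
  case False
  let ?S = "{0..1} \<times> {0..1} :: (real \<times> real) set"
  \<comment> \<open>A zero of \<open>w\<close> on a side would force the value of \<open>a\<close>
    or \<open>b\<close> belonging to that side to be zero.\<close>
  have "w z \<noteq> 0" if "z \<in> ?S" for z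
  proof -
    obtain s t where z: "z = (s, t)" "s \<in> {0..1}" "t \<in> {0..1}"
      using \<open>z \<in> ?S\<close> by auto
    then consider "s \<in> {0, 1}" | "t \<in> {0, 1}" | "z \<in> {0<..<1} \<times> {0<..<1}"
      by fastforce
    then show ?thesis
    proof cases
      case 1
      then show ?thesis using b[of s t] z False by auto
    next
      case 2
      then show ?thesis using a[of t s] z False by auto
    next
      case 3
      then show ?thesis by (rule nz)
    qed
  qed
  moreover have "contractible ?S"
    by (intro convex_imp_contractible convex_Times) auto
  ultimately obtain g where g: "continuous_on ?S g" and wg: "\<And>z. z \<in> ?S \<Longrightarrow> w z = (g z)\<^sup>2"
    using continuous_sqrt_on_contractible[OF cont] by metis
  have sq: "(Re (g z))\<^sup>2 = (cmod (w z) + Re (w z)) / 2" "(Im (g z))\<^sup>2 = (cmod (w z) - Re (w z)) / 2"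
      "Im (w z) = 2 * Re (g z) * Im (g z)" if "z \<in> ?S" for z
    using wg[OF that] by (simp_all add: norm_power cmod_power2 Re_power2 Im_power2)
  have Re: "Re (g (1, j)) = Re (g (0, j))" if "j \<in> {0, 1}" for j
    by (rule continuous_on_interval_power2_const[where c = "a j / 2"])
      (use that sq(1) a in \<open>auto intro!: continuous_intros continuous_on_square_sides(2)[OF g]\<close>)
  have Im: "Im (g (i, 1)) = Im (g (i, 0))" if "i \<in> {0, 1}" for i
    by (rule continuous_on_interval_power2_const[where c = "b i / 2"])
      (use that sq(2) b in \<open>auto intro!: continuous_intros continuous_on_square_sides(1)[OF g]\<close>)
  show ?thesis
    using Re[of 0] Re[of 1] Im[of 0] Im[of 1] by (simp add: sq(3))
qed

section \<open>Distances to the foci, and the diagonals\<close>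

lemma quadrilateral_sides:
  assumes "curvilinear_quadrilateral M d F A1 A2 Q"
  obtains a b
  where "\<And>s j. j \<in> {0, 1} \<Longrightarrow> s \<in> {0..1} \<Longrightarrow> d (Q (s, j)) A1 + d (Q (s, j)) A2 = a j"
    and "\<And>i t. i \<in> {0, 1} \<Longrightarrow> t \<in> {0..1} \<Longrightarrow> \<bar>d (Q (i, t)) A1 - d (Q (i, t)) A2\<bar> = b i"
proof -
  have "\<forall>j\<in>{0, 1}. \<exists>k. \<forall>s\<in>{0..1}. d (Q (s, j)) A1 + d (Q (s, j)) A2 = k"
    and "\<forall>i\<in>{0, 1}. \<exists>k. \<forall>t\<in>{0..1}. \<bar>d (Q (i, t)) A1 - d (Q (i, t)) A2\<bar> = k"
    using assms by (auto simp: curvilinear_quadrilateral_def ellipse_def hyperbola_def)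
  then show thesis
    using that by metis
qed

text \<open>A hyperbola fixes the difference of the distances only up to sign; continuity along the
  side fixes the sign. Then \<open>u\<close> is half the sum, constant on elliptic sides, and
  \<open>v\<close> half the difference, constant on hyperbolic sides.\<close>

lemma quadrilateral_elliptic_coordinates:
  assumes q: "curvilinear_quadrilateral M d F A1 A2 Q"
    and d1: "continuous_on M (\<lambda>P. d P A1)" and d2: "continuous_on M (\<lambda>P. d P A2)"
  obtains u v where "\<And>i j. i \<in> {0, 1} \<Longrightarrow> j \<in> {0, 1} \<Longrightarrow> d (Q (i, j)) A1 = u j + v i"
    and "\<And>i j. i \<in> {0, 1} \<Longrightarrow> j \<in> {0, 1} \<Longrightarrow> d (Q (i, j)) A2 = u j - v i"
proof -
  let ?S = "{0..1} \<times> {0..1} :: (real \<times> real) set"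
  define r1 where "r1 z = d (Q z) A1" for z
  define r2 where "r2 z = d (Q z) A2" for z
  have "continuous_on ?S Q" "Q ` ?S \<subseteq> M"
    using q by (auto simp: curvilinear_quadrilateral_def)
  then have cont: "continuous_on ?S r1" "continuous_on ?S r2"
    unfolding r1_def r2_def
    by (auto intro: continuous_on_compose2[OF d1] continuous_on_compose2[OF d2])
  obtain a b
    where a: "\<And>s j. j \<in> {0, 1} \<Longrightarrow> s \<in> {0..1} \<Longrightarrow> r1 (s, j) + r2 (s, j) = a j"
      and b: "\<And>i t. i \<in> {0, 1} \<Longrightarrow> t \<in> {0..1} \<Longrightarrow> \<bar>r1 (i, t) - r2 (i, t)\<bar> = b i"
    unfolding r1_def r2_def using quadrilateral_sides[OF q] by blast
  have sum: "r1 (1, j) + r2 (1, j) = r1 (0, j) + r2 (0, j)" if "j \<in> {0, 1}" for j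
    using a[OF that] by simp
  have diff: "r1 (i, 1) - r2 (i, 1) = r1 (i, 0) - r2 (i, 0)" if i: "i \<in> {0, 1}" for i
  proof (rule continuous_on_interval_power2_const[where c = "(b i)\<^sup>2"])
    show "continuous_on {0..1} (\<lambda>t. r1 (i, t) - r2 (i, t))"
      by (intro continuous_intros continuous_on_square_sides(1) cont i)
    show "(r1 (i, t) - r2 (i, t))\<^sup>2 = (b i)\<^sup>2" if "t \<in> {0..1}" for t
      using b[OF i that] by (metis power2_abs)
  qed
  have eq: "r1 (i, j) + r2 (i, j) = r1 (0, j) + r2 (0, j)"
    "r1 (i, j) - r2 (i, j) = r1 (i, 0) - r2 (i, 0)" if "i \<in> {0, 1}" "j \<in> {0, 1}" for i j
    using that sum diff by auto
  have "d (Q (i, j)) A1 = (r1 (0, j) + r2 (0, j)) / 2 + (r1 (i, 0) - r2 (i, 0)) / 2"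
    and "d (Q (i, j)) A2 = (r1 (0, j) + r2 (0, j)) / 2 - (r1 (i, 0) - r2 (i, 0)) / 2"
    if "i \<in> {0, 1}" "j \<in> {0, 1}" for i j
    using eq[OF that] unfolding r1_def[symmetric] r2_def[symmetric] by argo+
  then show thesis by (rule that)
qed

text \<open>Both geometries are treated at once: \<open>C\<close> is \<open>cos\<close> or \<open>cosh\<close>, \<open>B P R = C (d P R)\<close>, and
  \<open>\<sigma> = \<plusminus>1\<close> is the sign of the curvature. D'Alembert's equation is all that is needed about \<open>C\<close>.\<close>

lemma confocal_quadrilateral_diagonals:
  fixes C :: "real \<Rightarrow> real" and d B :: "'a::topological_space \<Rightarrow> 'a \<Rightarrow> real"
  assumes q: "curvilinear_quadrilateral M d F A1 A2 Q"
    and d1: "continuous_on M (\<lambda>P. d P A1)" and d2: "continuous_on M (\<lambda>P. d P A2)"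
    and D: "continuous_on M D"
    and C: "continuous_on UNIV C" "C 0 = 1" "\<And>x. C (- x) = C x"
      "\<And>x y. 2 * C x * C y = C (x + y) + C (x - y)"
    and m: "m\<^sup>2 \<noteq> 1"
    and gram: "\<And>P R. P \<in> M \<Longrightarrow> R \<in> M \<Longrightarrow> (1 - m\<^sup>2) * B P R = D P * D R
      + C (d P A1) * C (d R A1) + C (d P A2) * C (d R A2)
      - m * (C (d P A1) * C (d R A2) + C (d P A2) * C (d R A1))"
    and B: "\<And>P. P \<in> M \<Longrightarrow> B P P = 1"
    and F: "\<And>P. P \<in> M \<Longrightarrow> P \<notin> F \<Longrightarrow> (C (d P A1))\<^sup>2 \<noteq> 1 \<and> (C (d P A2))\<^sup>2 \<noteq> 1"
    and \<sigma>: "\<sigma>\<^sup>2 = 1"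
      "\<And>P. P \<in> M \<Longrightarrow> 0 \<le> \<sigma> * (C (d P A1 - d P A2) - C (d P A1 + d P A2))"
  shows "B (Q (0, 0)) (Q (1, 1)) = B (Q (1, 0)) (Q (0, 1))"
proof -
  let ?S = "{0..1} \<times> {0..1} :: (real \<times> real) set"
  have Q: "continuous_on ?S Q" and QM: "\<And>z. z \<in> ?S \<Longrightarrow> Q z \<in> M"
    using q by (auto simp: curvilinear_quadrilateral_def)
  have corners: "Q (0, 0) \<in> M" "Q (0, 1) \<in> M" "Q (1, 0) \<in> M" "Q (1, 1) \<in> M"
    by (auto intro: QM)
  define w where "w P = Complex (\<sigma> * (m - C (d P A1) * C (d P A2))) (D P)" for P
  \<comment> \<open>The Gram relation for \<open>R = P\<close> expresses
    \<open>(D P)\<^sup>2\<close> through the two values of \<open>C\<close>.\<close>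
  have norm_sq: "(cmod (w P))\<^sup>2 = (1 - (C (d P A1))\<^sup>2) * (1 - (C (d P A2))\<^sup>2)" if "P \<in> M" for P
    using gram[OF that that] B[OF that] \<sigma>(1)
    by (simp add: w_def cmod_power2 power_mult_distrib) algebra
  have prod: "C (x + y) * C (x - y) = (C x)\<^sup>2 + (C y)\<^sup>2 - 1" for x y
    using C(4)[of "x + y" "x - y"] C(4)[of x x] C(4)[of y y] C(2) by (simp add: power2_eq_square)
  \<comment> \<open>Both sides are nonnegative. Their squares agree because a squared half
    difference is the squared half sum minus the product, which \<open>prod\<close>
    evaluates.\<close>
  have cmod: "cmod (w P) = \<sigma> * (C (d P A1 - d P A2) - C (d P A1 + d P A2)) / 2"
    if "P \<in> M" for P
  proof (rule power2_eq_imp_eq)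
    show "(cmod (w P))\<^sup>2 = (\<sigma> * (C (d P A1 - d P A2) - C (d P A1 + d P A2)) / 2)\<^sup>2"
      using norm_sq[OF that] prod[of "d P A1" "d P A2"] C(4)[of "d P A1" "d P A2"] \<sigma>(1)
      by (simp add: power_divide power_mult_distrib) algebra
  qed (use \<sigma>(2)[OF that] in auto)
  \<comment> \<open>The product in \<open>Re (w P)\<close> is the half sum of \<open>C\<close> at
    the sum and at the difference of the distances, so one of the two terms cancels. Evenness of
    \<open>C\<close> admits the absolute value.\<close>
  have plus: "cmod (w P) + Re (w P) = \<sigma> * (m - C (d P A1 + d P A2))"
    and minus: "cmod (w P) - Re (w P) = \<sigma> * (C \<bar>d P A1 - d P A2\<bar> - m)" if "P \<in> M" for P
    using C(4)[of "d P A1" "d P A2"] C(3)[of "d P A1 - d P A2"]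
    by (simp_all add: cmod[OF that], auto simp: w_def field_simps abs_if)
  have contw: "continuous_on ?S (\<lambda>z. w (Q z))"
  proof -
    have "continuous_on M w"
      unfolding w_def
      by (intro continuous_intros D continuous_on_compose2[OF C(1) d1]
          continuous_on_compose2[OF C(1) d2] subset_UNIV)
    then show ?thesis
      by (rule continuous_on_compose2) (use Q QM in auto)
  qed
  obtain a b
    where a: "\<And>s j. j \<in> {0, 1} \<Longrightarrow> s \<in> {0..1} \<Longrightarrow> d (Q (s, j)) A1 + d (Q (s, j)) A2 = a j"
      and b: "\<And>i t. i \<in> {0, 1} \<Longrightarrow> t \<in> {0..1} \<Longrightarrow> \<bar>d (Q (i, t)) A1 - d (Q (i, t)) A2\<bar> = b i"
    using quadrilateral_sides[OF q] by blast
  have DD: "D (Q (0, 0)) * D (Q (1, 1)) = D (Q (1, 0)) * D (Q (0, 1))"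
  proof -
    have "Im (w (Q (0, 0))) * Im (w (Q (1, 1))) = Im (w (Q (1, 0))) * Im (w (Q (0, 1)))"
    proof (rule Im_products_of_opposite_corners[OF contw])
      fix z :: "real \<times> real"
      assume z: "z \<in> {0<..<1} \<times> {0<..<1}"
      then have "Q z \<notin> F"
        using q unfolding curvilinear_quadrilateral_def by blast
      moreover have "Q z \<in> M"
        using z by (intro QM) auto
      ultimately show "w (Q z) \<noteq> 0"
        using norm_sq[of "Q z"] F[of "Q z"] by auto
    next
      show "cmod (w (Q (s, j))) + Re (w (Q (s, j))) = \<sigma> * (m - C (a j))"
        if "j \<in> {0, 1}" "s \<in> {0..1}" for s j
        using plus[of "Q (s, j)"] QM[of "(s, j)"] a[OF that] that by auto
      show "cmod (w (Q (i, t))) - Re (w (Q (i, t))) = \<sigma> * (C (b i) - m)"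
        if "i \<in> {0, 1}" "t \<in> {0..1}" for i t
        using minus[of "Q (i, t)"] QM[of "(i, t)"] b[OF that] that by auto
    qed
    then show ?thesis by (simp add: w_def)
  qed
  obtain u v where uv: "\<And>i j. i \<in> {0, 1} \<Longrightarrow> j \<in> {0, 1} \<Longrightarrow> d (Q (i, j)) A1 = u j + v i"
    "\<And>i j. i \<in> {0, 1} \<Longrightarrow> j \<in> {0, 1} \<Longrightarrow> d (Q (i, j)) A2 = u j - v i"
    using quadrilateral_elliptic_coordinates[OF q d1 d2] by blast
  \<comment> \<open>Twice either side is the sum of the values of \<open>C\<close> at
    \<open>(x + x') + (y + y')\<close>, \<open>(x + x') - (y + y')\<close>,
    \<open>(x - x') + (y - y')\<close> and \<open>(x - x') - (y - y')\<close>.\<close>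
  have swap: "C (x + y) * C (x' + y') + C (x - y) * C (x' - y') =
      C (x + y') * C (x' + y) + C (x - y') * C (x' - y)" for x y x' y'
    using C(4)[of "x + y" "x' + y'"] C(4)[of "x - y" "x' - y'"]
      C(4)[of "x + y'" "x' + y"] C(4)[of "x - y'" "x' - y"]
    by (simp add: algebra_simps)
  have "(1 - m\<^sup>2) * B (Q (0, 0)) (Q (1, 1)) = (1 - m\<^sup>2) * B (Q (1, 0)) (Q (0, 1))"
    unfolding gram[OF corners(1,4)] gram[OF corners(3,2)] DD
    \<comment> \<open>The first instance exchanges the terms with equal foci, the second the mixed
      terms multiplied by \<open>m\<close>.\<close>
    using swap[of "u 0" "v 0" "u 1" "v 1"] swap[of "u 0" "v 0" "u 1" "- v 1"]
    by (simp add: uv algebra_simps)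
  then show ?thesis using m by simp
qed

section \<open>Gram determinants and inequalities in the two models\<close>

text \<open>The product of two determinants is the determinant of the inner products of
  \<open>a, b, p\<close> with \<open>a, b, r\<close>, here expanded along the first column.\<close>

lemma triple_product_gram:
  fixes a b p r :: "real^3"
  shows "(cross3 a b \<bullet> p) * (cross3 a b \<bullet> r) =
    (a \<bullet> a) * ((b \<bullet> b) * (p \<bullet> r) - (b \<bullet> p) * (b \<bullet> r))
    - (a \<bullet> b) * ((a \<bullet> b) * (p \<bullet> r) - (b \<bullet> p) * (a \<bullet> r))
    + (a \<bullet> p) * ((a \<bullet> b) * (b \<bullet> r) - (b \<bullet> b) * (a \<bullet> r))"
  by (simp add: cross3_simps)

text \<open>The sign on the left is the determinant of the matrix of the form, with diagonal
  \<open>1, 1, -1\<close>.\<close>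

lemma triple_product_minkowski_gram:
  fixes a b p r :: "real^3"
  shows "- ((cross3 a b \<bullet> p) * (cross3 a b \<bullet> r)) =
    minkowski_form a a * (minkowski_form b b * minkowski_form p r - minkowski_form b p * minkowski_form b r)
    - minkowski_form a b * (minkowski_form a b * minkowski_form p r - minkowski_form b p * minkowski_form a r)
    + minkowski_form a p * (minkowski_form a b * minkowski_form b r - minkowski_form b b * minkowski_form a r)"
  by (simp add: minkowski_form_def cross3_simps)

lemma inner_unit_vectors:
  fixes P R :: "real^3"
  assumes "P \<in> sphere 0 1" "R \<in> sphere 0 1"
  shows "\<bar>P \<bullet> R\<bar> \<le> 1" "(P \<bullet> R)\<^sup>2 = 1 \<longleftrightarrow> P = R \<or> P = - R"
proof -
  have 1: "norm P = 1" "norm R = 1"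
    using assms by auto
  show "\<bar>P \<bullet> R\<bar> \<le> 1"
    using Cauchy_Schwarz_ineq2[of P R] 1 by simp
  have "P \<bullet> P = 1" "R \<bullet> R = 1"
    using 1 by (auto simp: norm_eq_1)
  moreover have "P = R \<longleftrightarrow> (P - R) \<bullet> (P - R) = 0" "P = - R \<longleftrightarrow> (P + R) \<bullet> (P + R) = 0"
    by (auto simp: eq_neg_iff_add_eq_0)
  ultimately have "P = R \<longleftrightarrow> P \<bullet> R = 1" "P = - R \<longleftrightarrow> P \<bullet> R = - 1"
    by (auto simp: inner_simps inner_commute)
  then show "(P \<bullet> R)\<^sup>2 = 1 \<longleftrightarrow> P = R \<or> P = - R"
    by (auto simp: power2_eq_1_iff)
qed

lemma minkowski_form_hyperbolic_plane:
  assumes "P \<in> hyperbolic_plane" "R \<in> hyperbolic_plane"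
  shows "1 \<le> - minkowski_form P R" "(- minkowski_form P R)\<^sup>2 = 1 \<longleftrightarrow> P = R"
proof -
  have P: "(P $ 3)\<^sup>2 = 1 + (P $ 1)\<^sup>2 + (P $ 2)\<^sup>2" "P $ 3 > 0"
    and R: "(R $ 3)\<^sup>2 = 1 + (R $ 1)\<^sup>2 + (R $ 2)\<^sup>2" "R $ 3 > 0"
    using assms by (auto simp: hyperbolic_plane_def minkowski_form_def power2_eq_square)
  define s where "s = 1 + P $ 1 * R $ 1 + P $ 2 * R $ 2"
  \<comment> \<open>Lagrange's identity for the vectors \<open>(1, P $ 1, P $ 2)\<close> and
    \<open>(1, R $ 1, R $ 2)\<close>, with inner product \<open>s\<close>.\<close>
  have eq: "(P $ 3 * R $ 3)\<^sup>2 = s\<^sup>2 + (P $ 1 - R $ 1)\<^sup>2 + (P $ 2 - R $ 2)\<^sup>2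
      + (P $ 1 * R $ 2 - P $ 2 * R $ 1)\<^sup>2"
    unfolding power_mult_distrib P R s_def by (simp add: power2_eq_square algebra_simps)
  have le: "s \<le> P $ 3 * R $ 3"
    by (rule power2_le_imp_le) (use P(2) R(2) in \<open>simp_all add: eq\<close>)
  then show ge: "1 \<le> - minkowski_form P R"
    by (simp add: minkowski_form_def s_def)
  have "P = R" if "(- minkowski_form P R)\<^sup>2 = 1"
  proof -
    have "- minkowski_form P R = 1"
      using that ge by (auto simp: power2_eq_1_iff)
    then have "P $ 3 * R $ 3 = s"
      by (simp add: minkowski_form_def s_def)
    then have "(P $ 1 - R $ 1)\<^sup>2 + (P $ 2 - R $ 2)\<^sup>2 + (P $ 1 * R $ 2 - P $ 2 * R $ 1)\<^sup>2 = 0"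
      using eq by simp
    then have "P $ 1 = R $ 1" "P $ 2 = R $ 2"
      by (simp_all add: add_nonneg_eq_0_iff)
    moreover from this have "P $ 3 = R $ 3"
      using P R by (intro power2_eq_imp_eq[of "P $ 3"]) simp_all
    ultimately show ?thesis
      by (simp add: vec_eq_iff forall_3)
  qed
  moreover have "minkowski_form P P = - 1"
    using assms by (simp add: hyperbolic_plane_def)
  ultimately show "(- minkowski_form P R)\<^sup>2 = 1 \<longleftrightarrow> P = R"
    by auto
qed

section \<open>The sphere and the hyperbolic plane\<close>

lemma spherical_quadrilateral_diagonals:
  assumes A: "A1 \<in> sphere 0 1" "A2 \<in> sphere 0 1" "A1 \<noteq> A2" "A1 \<noteq> - A2"
    and q: "spherical_quadrilateral A1 A2 Q"
  shows "sphere_dist (Q (0, 0)) (Q (1, 1)) = sphere_dist (Q (1, 0)) (Q (0, 1))"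
proof -
  have cos: "cos (sphere_dist P R) = P \<bullet> R" if "P \<in> sphere 0 1" "R \<in> sphere 0 1" for P R
    using inner_unit_vectors(1)[OF that] by (auto simp: sphere_dist_def)
  have cont: "continuous_on (sphere 0 1) (\<lambda>P. sphere_dist P A)" if "A \<in> sphere 0 1" for A
    unfolding sphere_dist_def
    by (intro continuous_intros ballI)
      (use inner_unit_vectors(1)[OF _ that] in \<open>auto simp: abs_le_iff minus_le_iff\<close>)
  have self: "P \<bullet> P = 1" if "P \<in> sphere 0 1" for P :: "real^3"
    using that by (auto simp: norm_eq_1)
  have "Q (0, 0) \<bullet> Q (1, 1) = Q (1, 0) \<bullet> Q (0, 1)"
  proof (rule confocal_quadrilateral_diagonals[where C = cos and B = "(\<bullet>)" and \<sigma> = 1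
        and D = "\<lambda>P. cross3 A1 A2 \<bullet> P" and m = "A1 \<bullet> A2",
        OF q[unfolded spherical_quadrilateral_def] cont[OF A(1)] cont[OF A(2)]])
    show "(A1 \<bullet> A2)\<^sup>2 \<noteq> 1"
      using inner_unit_vectors(2)[OF A(1,2)] A(3,4) by simp
  next
    fix P R :: "real^3"
    assume "P \<in> sphere 0 1" "R \<in> sphere 0 1"
    then show "(1 - (A1 \<bullet> A2)\<^sup>2) * (P \<bullet> R) = cross3 A1 A2 \<bullet> P * (cross3 A1 A2 \<bullet> R)
      + cos (sphere_dist P A1) * cos (sphere_dist R A1)
      + cos (sphere_dist P A2) * cos (sphere_dist R A2)
      - A1 \<bullet> A2 * (cos (sphere_dist P A1) * cos (sphere_dist R A2)
        + cos (sphere_dist P A2) * cos (sphere_dist R A1))"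
      unfolding triple_product_gram
      by (simp only: cos A self) (simp add: inner_commute power2_eq_square algebra_simps)
  next
    fix P :: "real^3"
    assume P: "P \<in> sphere 0 1"
    \<comment> \<open>The difference is twice the product of the sines of two distances in
      \<open>[0, pi]\<close>.\<close>
    show "0 \<le> 1 * (cos (sphere_dist P A1 - sphere_dist P A2) - cos (sphere_dist P A1 + sphere_dist P A2))"
      using inner_unit_vectors(1)[OF P A(1)] inner_unit_vectors(1)[OF P A(2)]
      by (auto simp: cos_add cos_diff sphere_dist_def abs_le_iff
          intro!: mult_nonneg_nonneg sin_ge_zero arccos_lbound arccos_ubound)
    assume "P \<notin> {A1, A2, - A1, - A2}"
    then show "(cos (sphere_dist P A1))\<^sup>2 \<noteq> 1 \<and> (cos (sphere_dist P A2))\<^sup>2 \<noteq> 1"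
      using inner_unit_vectors(2)[OF P A(1)] inner_unit_vectors(2)[OF P A(2)]
      by (simp add: cos[OF P A(1)] cos[OF P A(2)])
  qed (auto simp: cos_add cos_diff self intro!: continuous_intros)
  then show ?thesis
    by (simp add: sphere_dist_def)
qed

lemma hyperbolic_quadrilateral_diagonals:
  assumes A: "A1 \<in> hyperbolic_plane" "A2 \<in> hyperbolic_plane" "A1 \<noteq> A2"
    and q: "hyperbolic_quadrilateral A1 A2 Q"
  shows "hyperbolic_dist (Q (0, 0)) (Q (1, 1)) = hyperbolic_dist (Q (1, 0)) (Q (0, 1))"
proof -
  have cosh: "cosh (hyperbolic_dist P R) = - minkowski_form P R"
    and nonneg: "0 \<le> hyperbolic_dist P R"
    if "P \<in> hyperbolic_plane" "R \<in> hyperbolic_plane" for P R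
    using minkowski_form_hyperbolic_plane(1)[OF that] by (auto simp: hyperbolic_dist_def)
  have *: "continuous_on hyperbolic_plane (\<lambda>P. - minkowski_form P A)" for A
    unfolding minkowski_form_def by (intro continuous_intros)
  have cont: "continuous_on hyperbolic_plane (\<lambda>P. hyperbolic_dist P A)"
    if "A \<in> hyperbolic_plane" for A
    unfolding hyperbolic_dist_def
    by (rule continuous_on_compose2[OF continuous_on_arcosh[OF order.refl] *]) (use minkowski_form_hyperbolic_plane(1)[OF _ that] in auto)
  have self: "minkowski_form P P = - 1" if "P \<in> hyperbolic_plane" for P
    using that by (simp add: hyperbolic_plane_def)
  have comm: "minkowski_form P R = minkowski_form R P" for P R
    by (simp add: minkowski_form_def mult.commute)
  have "- minkowski_form (Q (0, 0)) (Q (1, 1)) = - minkowski_form (Q (1, 0)) (Q (0, 1))"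
  proof (rule confocal_quadrilateral_diagonals[where C = cosh and \<sigma> = "- 1"
        and B = "\<lambda>P R. - minkowski_form P R"
        and D = "\<lambda>P. cross3 A1 A2 \<bullet> P" and m = "- minkowski_form A1 A2",
        OF q[unfolded hyperbolic_quadrilateral_def] cont[OF A(1)] cont[OF A(2)]])
    show "(- minkowski_form A1 A2)\<^sup>2 \<noteq> 1"
      using minkowski_form_hyperbolic_plane(2)[OF A(1,2)] A(3) by simp
  next
    fix P R
    assume "P \<in> hyperbolic_plane" "R \<in> hyperbolic_plane"
    \<comment> \<open>Replacing the form by its negative changes the sign of the cubic Gram
      determinant. This cancels the Minkowski sign and gives the same relation as on the
      sphere.\<close>
    then show "(1 - (- minkowski_form A1 A2)\<^sup>2) * - minkowski_form P R
      = cross3 A1 A2 \<bullet> P * (cross3 A1 A2 \<bullet> R)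
      + cosh (hyperbolic_dist P A1) * cosh (hyperbolic_dist R A1)
      + cosh (hyperbolic_dist P A2) * cosh (hyperbolic_dist R A2)
      - - minkowski_form A1 A2 * (cosh (hyperbolic_dist P A1) * cosh (hyperbolic_dist R A2)
        + cosh (hyperbolic_dist P A2) * cosh (hyperbolic_dist R A1))"
      using triple_product_minkowski_gram[of A1 A2 P R]
      by (simp only: cosh A self comm[of P A1] comm[of P A2] comm[of R A1] comm[of R A2])
        (simp add: power2_eq_square algebra_simps)
  next
    fix P
    assume P: "P \<in> hyperbolic_plane"
    \<comment> \<open>Twice the product of two values of \<open>sinh\<close> at nonnegative
      distances; this is why \<open>\<sigma>\<close> is negative here.\<close>
    show "0 \<le> - 1 * (cosh (hyperbolic_dist P A1 - hyperbolic_dist P A2)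
        - cosh (hyperbolic_dist P A1 + hyperbolic_dist P A2))"
      using nonneg[OF P A(1)] nonneg[OF P A(2)]
      by (simp add: cosh_add cosh_diff)
    assume "P \<notin> {A1, A2}"
    then show "(cosh (hyperbolic_dist P A1))\<^sup>2 \<noteq> 1 \<and> (cosh (hyperbolic_dist P A2))\<^sup>2 \<noteq> 1"
      using minkowski_form_hyperbolic_plane(2)[OF P A(1)] minkowski_form_hyperbolic_plane(2)[OF P A(2)]
      by (simp add: cosh[OF P A(1)] cosh[OF P A(2)])
  qed (auto simp: cosh_add cosh_diff self intro!: continuous_intros)
  then show ?thesis
    by (simp add: hyperbolic_dist_def)
qed

theorem theorem7:
  shows "(\<forall>(A1 :: real^3) (A2 :: real^3) (Q :: real \<times> real \<Rightarrow> real^3).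
            A1 \<in> sphere 0 1 \<and> A2 \<in> sphere 0 1 \<and> A1 \<noteq> A2 \<and> A1 \<noteq> - A2 \<and>
            spherical_quadrilateral A1 A2 Q \<longrightarrow>
            sphere_dist (Q (0, 0)) (Q (1, 1)) = sphere_dist (Q (1, 0)) (Q (0, 1)))
       \<and> (\<forall>(A1 :: real^3) (A2 :: real^3) (Q :: real \<times> real \<Rightarrow> real^3).
            A1 \<in> hyperbolic_plane \<and> A2 \<in> hyperbolic_plane \<and> A1 \<noteq> A2 \<and>
            hyperbolic_quadrilateral A1 A2 Q \<longrightarrow>
            hyperbolic_dist (Q (0, 0)) (Q (1, 1)) = hyperbolic_dist (Q (1, 0)) (Q (0, 1)))"
  using spherical_quadrilateral_diagonals hyperbolic_quadrilateral_diagonals by blast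

end
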